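(* Let $G=(V,E)$ be a graph. The trivariate chromatic polynomial $\tilde P(G,x,y,z)$ and the edge elimination polynomial $\xi(G,x,y,z)$ are equivalent graph polynomials (each can be calculated from the other), related by the following identities of rational functions in $x,y,z$: $$\tilde P(G,x,y,z)=\xi\bigl(G,\,x,\,z-1,\,(1-z)(x-y)\bigr),$$ $$\xi(G,x,y,z)=\tilde P\left(G,\,x,\,x+\frac{z}{y},\,y+1\right).$$
   Context: Graphs are finite. A graph $G=(V,E)$ consists of a vertex set $V$ and a multiset $E$ of edges, each edge being a one- or two-element subset of $V$ (loops and parallel edges allowed). A vertex $w$ and an edge $e$ are incident if $w\in e$. For an edge $e$ of $G$: $G_{-e}$ (deletion) is $G$ with the edge $e$ removed; $G_{/e}$ (contraction) is obtained by removing $e$ and merging its incident vertices into one vertex (parallel edges and loops may occur; if $e$ is a loop then $G_{/e}=G_{-e}$); $G_{\dagger e}$ (extraction) is obtained by deleting all vertices incident to $e$ together with all edges incident to these vertices. $G^1\mathbin{\dot\cup} G^2$ is the disjoint union, and $K_1$ is the graph with one vertex and no edges. Trivariate chromatic polynomial: for nonnegative integers $y\le x$, $$\tilde P(G,x,y,z)=\sum_{\phi\colon V\to\{1,\dots,x\}} z^{\,|\{e\in E\,:\,\exists c\le y\ \forall w\in e\colon \phi(w)=c\}|},$$ where edges are counted with multiplicity. These values are given by a unique polynomial in $x,y,z$, and $\tilde P(G,x,y,z)$ denotes this polynomial. Edge elimination polynomial: $\xi(G,x,y,z)$ is the (well-defined, isomorphism-invariant) graph polynomial determined by $\xi(G,x,y,z)=\xi(G_{-e},x,y,z)+y\,\xi(G_{/e},x,y,z)+z\,\xi(G_{\dagger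 e},x,y,z)$ for every edge $e$ of $G$, $\xi(G^1\mathbin{\dot\cup} G^2,x,y,z)=\xi(G^1,x,y,z)\,\xi(G^2,x,y,z)$, and $\xi(K_1,x,y,z)=x$; the graph without vertices has value $1$. Its existence and uniqueness is a known result. *)

theory Defs
  imports
    "HOL-Library.Multiset"
    "HOL-Library.FuncSet"
    "HOL-Computational_Algebra.Polynomial_Factorial"
begin

typedef 'v multigraph =
  "{(V :: 'v set, E :: 'v set multiset).
      finite V \<and> (\<forall>e\<in>#E. e \<subseteq> V \<and> (card e = 1 \<or> card e = 2))}"
  by (rule exI[of _ "({}, {#})"]) simp

setup_lifting type_definition_multigraph

lift_definition verts :: "'v multigraph \<Rightarrow> 'v set" is fst .

lift_definition edges :: "'v multigraph \<Rightarrow> 'v set multiset" is snd .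

lift_definition empty_graph :: "'v multigraph" is "({}, {#})"
  by simp

lift_definition K1 :: "'v \<Rightarrow> 'v multigraph" is "\<lambda>v. ({v}, {#})"
  by simp

lift_definition delete_edge :: "'v multigraph \<Rightarrow> 'v set \<Rightarrow> 'v multigraph"
  is "\<lambda>(V, E) e. (V, E - {#e#})"
  by (auto dest: in_diffD)

text \<open>Contraction keeps the name of one arbitrarily chosen vertex of the contracted edge for the
  merged vertex. For a loop, merging is the identity, so that contraction equals deletion.\<close>

definition merge :: "'v set \<Rightarrow> 'v \<Rightarrow> 'v" where
  "merge e w = (if w \<in> e then (SOME u. u \<in> e) else w)"

lemma card_image_1_or_2:
  assumes "card e = 1 \<or> card e = 2"
  shows "card (f ` e) = 1 \<or> card (f ` e) = 2"
proof -
  have fin: "finite e" and ne: "e \<noteq> {}"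
    using assms by (auto intro: card_ge_0_finite)
  have "card (f ` e) \<le> card e" "card (f ` e) \<noteq> 0"
    using fin ne by (auto intro: card_image_le)
  then show ?thesis using assms by linarith
qed

lift_definition contract_edge :: "'v multigraph \<Rightarrow> 'v set \<Rightarrow> 'v multigraph"
  is "\<lambda>(V, E) e. (merge e ` V, image_mset ((`) (merge e)) (E - {#e#}))"
proof -
  fix VE :: "'v set \<times> 'v set multiset" and e :: "'v set"
  assume wf: "VE \<in> {(V, E). finite V \<and> (\<forall>e\<in>#E. e \<subseteq> V \<and> (card e = 1 \<or> card e = 2))}"
  obtain V E where VE: "VE = (V, E)" by (cases VE)
  have "merge e ` f \<subseteq> merge e ` V \<and> (card (merge e ` f) = 1 \<or> card (merge e ` f) = 2)"
    if "f \<in># E - {#e#}" for f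
    using wf that card_image_1_or_2[of f "merge e"] by (auto simp: VE dest!: in_diffD)
  then show "?thesis VE e"
    using wf by (auto simp: VE)
qed

lift_definition extract_edge :: "'v multigraph \<Rightarrow> 'v set \<Rightarrow> 'v multigraph"
  is "\<lambda>(V, E) e. (V - e, {# f \<in># E. f \<inter> e = {} #})"
  by auto

text \<open>The disjoint union of two graphs whose vertex sets are disjoint.\<close>

lift_definition union_graph :: "'v multigraph \<Rightarrow> 'v multigraph \<Rightarrow> 'v multigraph"
  is "\<lambda>(V, E) (V', E'). (V \<union> V', E + E')"
  by fastforce

definition isomorphic :: "'v multigraph \<Rightarrow> 'v multigraph \<Rightarrow> bool" where
  "isomorphic G H \<longleftrightarrow>
     (\<exists>f. bij_betw f (verts G) (verts H) \<and> edges H = image_mset ((`) f) (edges G))"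


text \<open>Polynomials in \<open>x\<close>, \<open>y\<close>, \<open>z\<close> over the integers are elements of the iterated polynomial ring
  in which \<open>x\<close> is the innermost and \<open>z\<close> the outermost variable. The substitution
  \<open>subst3 p a b c\<close> is \<open>p(a, b, c)\<close>, with values in an arbitrary commutative ring.\<close>

type_synonym poly3 = "int poly poly poly"

type_synonym ratfun3 = "poly3 fract"

definition var_x :: poly3 where "var_x = [:[:[:0, 1:]:]:]"
definition var_y :: poly3 where "var_y = [:[:0, 1:]:]"
definition var_z :: poly3 where "var_z = [:0, 1:]"

definition subst3 :: "poly3 \<Rightarrow> 'a \<Rightarrow> 'a \<Rightarrow> 'a \<Rightarrow> 'a :: comm_ring_1" where
  "subst3 p a b c =
     poly (map_poly (\<lambda>q. poly (map_poly (\<lambda>r. poly (map_poly of_int r) a) q) b) p) c"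


definition coloring_sum :: "'v multigraph \<Rightarrow> nat \<Rightarrow> nat \<Rightarrow> 'a \<Rightarrow> 'a :: comm_ring_1" where
  "coloring_sum G x y z =
     (\<Sum>\<phi> \<in> verts G \<rightarrow>\<^sub>E {1..x}.
        z ^ size {# e \<in># edges G. \<exists>c\<le>y. \<forall>w\<in>e. \<phi> w = c #})"

text \<open>The arguments \<open>x\<close> and \<open>y\<close> range over the natural numbers with \<open>y \<le> x\<close>, whereas \<open>z\<close> stays an
  indeterminate: the values compared are elements of \<open>int poly\<close>.\<close>

definition trivariate_chromatic :: "'v multigraph \<Rightarrow> poly3" where
  "trivariate_chromatic G =
     (THE p. \<forall>x y :: nat. y \<le> x \<longrightarrow>
        subst3 p (of_nat x) (of_nat y) [:0, 1:] = coloring_sum G x y ([:0, 1:] :: int poly))"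


definition is_edge_elimination :: "('v multigraph \<Rightarrow> poly3) \<Rightarrow> bool" where
  "is_edge_elimination F \<longleftrightarrow>
     (\<forall>G H. isomorphic G H \<longrightarrow> F G = F H) \<and>
     (\<forall>G e. e \<in># edges G \<longrightarrow>
        F G = F (delete_edge G e) + var_y * F (contract_edge G e) + var_z * F (extract_edge G e)) \<and>
     (\<forall>G H. verts G \<inter> verts H = {} \<longrightarrow> F (union_graph G H) = F G * F H) \<and>
     (\<forall>v. F (K1 v) = var_x) \<and>
     F empty_graph = 1"

definition edge_elimination :: "'v multigraph \<Rightarrow> poly3" where
  "edge_elimination = (THE F. is_edge_elimination F)"


text \<open>Each graph polynomial can be calculated from the other one, uniformly in the graph.\<close>

definition equivalent_graph_polynomials ::
    "('v multigraph \<Rightarrow> poly3) \<Rightarrow> ('v multigraph \<Rightarrow> poly3) \<Rightarrow> bool" where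
  "equivalent_graph_polynomials P Q \<longleftrightarrow>
     (\<exists>f. \<forall>G. P G = f (Q G)) \<and> (\<exists>g. \<forall>G. Q G = g (P G))"

end

theory Submission imports Defs begin

text \<open>Both polynomials obey one and the same recurrence, with different coefficients. Fix an edge
  \<open>e\<close> and naturals \<open>y \<le> x\<close>, and call a color low if it is at most \<open>y\<close>. Putting \<open>e\<close> back into
  \<open>G\<^sub>-\<^sub>e\<close> multiplies the weight of exactly those colorings by \<open>z\<close> that are constant on
  \<open>e\<close> with a low color. The colorings of \<open>G\<^sub>/\<^sub>e\<close> are those constant on \<open>e\<close> with any
  color, and among them the ones with a high color on \<open>e\<close> arise from the colorings of the extraction
  by a free choice among \<open>x - y\<close> colors, because no edge that touches \<open>e\<close> is then counted. Hence
  the coloring sum satisfies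
  \<open>F(G) = F(G\<^sub>-\<^sub>e) + b F(G\<^sub>/\<^sub>e) + c F(G\<^sub>\<dagger>\<^sub>e)\<close> with \<open>b = z - 1\<close> and
  \<open>c = (1 - z)(x - y)\<close>, and \<open>F(G) = x\<^sup>n\<close> on \<open>n\<close> vertices without edges
  (\<open>elimination_coloring_sum\<close>).

  Unfolding this recurrence down to edgeless graphs computes \<open>F(G)\<close> as the value at \<open>(x, b, c)\<close>
  of a polynomial that depends on \<open>G\<close> only (\<open>elimination_polynomial\<close>). This one remark is used
  three times. It shows that the coloring sums are values of a polynomial, so that the trivariate
  chromatic polynomial exists; that the recurrence with given coefficients has at most one solution;
  and that a solution over the rational functions with coefficients \<open>x, y, z\<close> consists of polynomials.

  The substitution \<open>y \<mapsto> x + z/y\<close>, \<open>z \<mapsto> y + 1\<close> turns \<open>z - 1\<close> into \<open>y\<close> and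
  \<open>(1 - z)(x - y)\<close> into \<open>z\<close>. Applied to the trivariate chromatic polynomial, it therefore produces
  a solution of the recurrence of \<open>\<xi>\<close>; being invariant under isomorphism and multiplicative, as
  coloring sums are, this solution proves that \<open>\<xi>\<close> exists and gives the second identity at once
  (\<open>edge_elimination_eq_trivariate_chromatic\<close>). The first
  identity holds since both of its sides solve the recurrence with coefficients \<open>x\<close>, \<open>z - 1\<close>, \<open>(1 - z)(x - y)\<close>.\<close>


section \<open>Substitution into trivariate polynomials\<close>

text \<open>Substitution is handled through its universal property: it is the only ring homomorphism with
  prescribed values at the three variables (\<open>unital_hom_eq_subst3\<close>). Homomorphisms on types are all
  that occurs, so a plain predicate carries them.\<close>

definition unital_hom :: "('a::comm_ring_1 \<Rightarrow> 'b::comm_ring_1) \<Rightarrow> bool" where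
  "unital_hom h \<longleftrightarrow> h 1 = 1 \<and> (\<forall>a b. h (a + b) = h a + h b) \<and> (\<forall>a b. h (a * b) = h a * h b)"

lemma unital_homD:
  assumes "unital_hom h"
  shows "h 1 = 1" "h (a + b) = h a + h b" "h (a * b) = h a * h b"
    "h 0 = 0" "h (- a) = - h a" "h (a - b) = h a - h b" "h (a ^ n) = h a ^ n"
proof -
  show one: "h 1 = 1" and add: "h (a + b) = h a + h b" and mult: "h (a * b) = h a * h b" for a b
    using assms by (auto simp: unital_hom_def)
  have "h 0 + h 0 = h 0 + 0" using add[of 0 0] by simp
  then show zero: "h 0 = 0" by (simp only: add_left_cancel)
  have "h (- a) + h a = 0" for a using add[of "- a" a] zero by simp
  then show minus: "h (- a) = - h a" for a using eq_neg_iff_add_eq_0 by blast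
  show "h (a - b) = h a - h b" using add[of a "- b"] minus by simp
  show "h (a ^ n) = h a ^ n" by (induction n) (simp_all add: one mult)
qed

lemma unital_hom_comp: "unital_hom h \<Longrightarrow> unital_hom k \<Longrightarrow> unital_hom (\<lambda>a. k (h a))"
  by (simp add: unital_hom_def)

lemma unital_hom_of_int: "unital_hom (of_int :: int \<Rightarrow> 'a::comm_ring_1)"
  by (simp add: unital_hom_def)

lemma poly_map_poly_pCons:
  assumes "h 0 = 0"
  shows "poly (map_poly h (pCons c p)) a = h c + a * poly (map_poly h p) a"
  using assms by (cases "pCons c p = 0") (auto simp: map_poly_pCons)

lemma unital_hom_poly_map_poly:
  assumes "unital_hom h"
  shows "unital_hom (\<lambda>p. poly (map_poly h p) a)"
proof -
  note h = unital_homD[OF assms]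
  have add: "poly (map_poly h (p + q)) a = poly (map_poly h p) a + poly (map_poly h q) a" for p q
  proof -
    have "map_poly h (p + q) = map_poly h p + map_poly h q"
      by (rule poly_eqI) (simp add: coeff_map_poly h)
    then show ?thesis by simp
  qed
  have smult: "poly (map_poly h (smult c q)) a = h c * poly (map_poly h q) a" for c q
  proof -
    have "map_poly h (smult c q) = smult (h c) (map_poly h q)"
      by (rule poly_eqI) (simp add: coeff_map_poly h)
    then show ?thesis by simp
  qed
  have "poly (map_poly h (p * q)) a = poly (map_poly h p) a * poly (map_poly h q) a" for p q
    by (induction p) (simp_all add: h add smult poly_map_poly_pCons algebra_simps)
  moreover have "poly (map_poly h 1) a = 1"
    using poly_map_poly_pCons[of h 1 0 a] by (simp add: h)
  ultimately show ?thesis using add by (simp add: unital_hom_def)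
qed

lemma unital_hom_subst3: "unital_hom (\<lambda>p. subst3 p a b c)"
  unfolding subst3_def by (intro unital_hom_poly_map_poly unital_hom_of_int)

lemma unital_hom_const: "unital_hom (\<lambda>c. [:c:])"
  by (simp add: unital_hom_def flip: one_pCons)

lemma unital_hom_poly_unique:
  assumes "unital_hom H"
  shows "H p = poly (map_poly (\<lambda>c. H [:c:]) p) (H [:0, 1:])"
proof (induction p)
  case 0
  then show ?case by (simp add: unital_homD[OF assms])
next
  case (pCons c p)
  have "H (pCons c p) = H ([:c:] + [:0, 1:] * p)" by simp
  also have "\<dots> = H [:c:] + H [:0, 1:] * H p" by (simp only: unital_homD[OF assms])
  finally show ?case using pCons by (simp add: poly_map_poly_pCons unital_homD[OF assms])
qed

lemma unital_hom_int_unique: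
  assumes "unital_hom (H :: int \<Rightarrow> 'a::comm_ring_1)"
  shows "H = of_int"
proof
  note h = unital_homD[OF assms]
  fix i :: int
  have nat: "H (int n) = of_nat n" for n by (induction n) (simp_all add: h)
  show "H i = of_int i"
    by (cases i rule: int_cases2) (simp_all only: h(5) nat of_int_of_nat_eq of_int_minus)
qed

text \<open>A polynomial is built from its constants and its variable, so a homomorphism on a polynomial
  ring is an evaluation; peeling off \<open>z\<close>, \<open>y\<close> and \<open>x\<close> in turn leaves a homomorphism on the
  integers, of which there is only one.\<close>

lemma unital_hom_eq_subst3:
  assumes "unital_hom H"
  shows "H p = subst3 p (H var_x) (H var_y) (H var_z)"
proof -
  have H1: "unital_hom (\<lambda>q. H [:q:])"
    using unital_hom_comp[OF unital_hom_const assms] .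
  have H2: "unital_hom (\<lambda>r. H [:[:r:]:])"
    using unital_hom_comp[OF unital_hom_const H1] .
  have H3: "(\<lambda>i. H [:[:[:i:]:]:]) = of_int"
    using unital_hom_int_unique[OF unital_hom_comp[OF unital_hom_const H2]] .
  have "(\<lambda>r. H [:[:r:]:]) = (\<lambda>r. poly (map_poly of_int r) (H var_x))"
    using unital_hom_poly_unique[OF H2] unfolding H3 var_x_def by blast
  moreover have "(\<lambda>q. H [:q:]) = (\<lambda>q. poly (map_poly (\<lambda>r. H [:[:r:]:]) q) (H var_y))"
    using unital_hom_poly_unique[OF H1] unfolding var_y_def by blast
  moreover have "H p = poly (map_poly (\<lambda>q. H [:q:]) p) (H var_z)"
    using unital_hom_poly_unique[OF assms] unfolding var_z_def by blast
  ultimately show ?thesis unfolding subst3_def by simp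
qed

lemma subst3_var [simp]:
  "subst3 var_x a b c = a" "subst3 var_y a b c = b" "subst3 var_z a b c = c"
  by (simp_all add: subst3_def var_x_def var_y_def var_z_def poly_map_poly_pCons)

lemmas subst3_hom [simp] = unital_homD[OF unital_hom_subst3]

lemma hom_subst3:
  assumes "unital_hom H"
  shows "H (subst3 p a b c) = subst3 p (H a) (H b) (H c)"
  using unital_hom_eq_subst3[OF unital_hom_comp[OF unital_hom_subst3[of a b c] assms]] by simp

lemma subst3_subst3: "subst3 (subst3 p a b c) u v w
    = subst3 p (subst3 a u v w) (subst3 b u v w) (subst3 c u v w)"
  by (rule hom_subst3[OF unital_hom_subst3])

lemma unital_hom_to_fract: "unital_hom (to_fract :: poly3 \<Rightarrow> ratfun3)"
  by (simp add: unital_hom_def)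

lemma to_fract_eq_subst3:
  "to_fract p = subst3 p (to_fract var_x) (to_fract var_y) (to_fract var_z)"
  by (rule unital_hom_eq_subst3[OF unital_hom_to_fract])

text \<open>With \<open>z\<close> kept as an indeterminate, the substitution acts on each coefficient of \<open>z\<close>
  separately: both descriptions are homomorphisms with the same values at the variables.\<close>

lemma coeff_subst3:
  "coeff (subst3 p (of_nat x) (of_nat y) [:0, 1:] :: int poly) k
     = poly (poly (coeff p k) [:int y:]) (int x)"
proof -
  have ev: "unital_hom (\<lambda>q. [:poly (poly q [:int y:]) (int x):])"
    by (simp add: unital_hom_def one_pCons)
  let ?H = "\<lambda>p. poly (map_poly (\<lambda>q. [:poly (poly q [:int y:]) (int x):]) p) [:0, 1:]"
  have "?H p = subst3 p (of_nat x) (of_nat y) [:0, 1:]"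
    using unital_hom_eq_subst3[OF unital_hom_poly_map_poly[OF ev, of "[:0, 1:]"], of p]
    by (simp add: var_x_def var_y_def var_z_def poly_map_poly_pCons of_nat_poly one_pCons)
  moreover have "coeff (?H p) k = poly (poly (coeff p k) [:int y:]) (int x)" for k
    by (induction p arbitrary: k) (auto simp: poly_map_poly_pCons coeff_pCons split: nat.splits)
  ultimately show ?thesis by simp
qed

text \<open>The points with \<open>y \<le> x\<close> do not form a grid, but they contain infinitely many \<open>x\<close> for each
  \<open>y\<close>. So the root bound is applied first in \<open>x\<close>, for a fixed \<open>y\<close>, and then in \<open>y\<close>,
  over the domain of integer polynomials in \<open>x\<close>.\<close>

lemma poly3_eqI:
  assumes "\<And>x y :: nat. y \<le> x \<Longrightarrow>
    (subst3 p (of_nat x) (of_nat y) [:0, 1:] :: int poly) = subst3 q (of_nat x) (of_nat y) [:0, 1:]"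
  shows "p = q"
proof (rule poly_eqI)
  fix k
  define r where "r = coeff p k - coeff q k"
  have "poly (poly r [:int y:]) (int x) = 0" if "y \<le> x" for x y
    using assms[OF that] by (simp add: r_def flip: coeff_subst3)
  then have "int ` {y..} \<subseteq> {x. poly (poly r [:int y:]) x = 0}" for y by auto
  moreover have "infinite (int ` {y..})" for y :: nat
    by (simp add: finite_image_iff infinite_Ici)
  ultimately have "poly r [:int y:] = 0" for y
    using poly_roots_finite infinite_super by blast
  then have "range (\<lambda>y. [:int y:]) \<subseteq> {a. poly r a = 0}" by auto
  moreover have "infinite (range (\<lambda>y. [:int y:]))"
    by (subst finite_image_iff) (auto intro: injI)
  ultimately have "r = 0"
    using poly_roots_finite infinite_super by blast
  then show "coeff p k = coeff q k" by (simp add: r_def)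
qed

section \<open>Multigraphs\<close>

lemma multigraph_eqI: "verts G = verts H \<Longrightarrow> edges G = edges H \<Longrightarrow> G = H"
  by transfer (auto simp: prod_eq_iff)

lemma finite_verts [simp]: "finite (verts G)"
  by transfer auto

lemma edge_subset: "f \<in># edges G \<Longrightarrow> f \<subseteq> verts G"
  by transfer fastforce

lemma edge_nonempty: "f \<in># edges G \<Longrightarrow> f \<noteq> {}"
  by transfer fastforce

lemma graph_simps [simp]:
  "verts empty_graph = {}" "edges empty_graph = {#}"
  "verts (K1 v) = {v}" "edges (K1 v) = {#}"
  "verts (delete_edge G e) = verts G" "edges (delete_edge G e) = edges G - {#e#}"
  "verts (contract_edge G e) = merge e ` verts G"
  "edges (contract_edge G e) = image_mset ((`) (merge e)) (edges G - {#e#})"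
  "verts (extract_edge G e) = verts G - e"
  "edges (extract_edge G e) = {# f \<in># edges G. f \<inter> e = {} #}"
  "verts (union_graph G H) = verts G \<union> verts H"
  "edges (union_graph G H) = edges G + edges H"
  by (transfer; auto)+

lemma size_edges_eliminate:
  assumes "e \<in># edges G"
  shows "size (edges (delete_edge G e)) < size (edges G)"
    "size (edges (contract_edge G e)) < size (edges G)"
    "size (edges (extract_edge G e)) < size (edges G)"
proof -
  show "size (edges (delete_edge G e)) < size (edges G)"
    "size (edges (contract_edge G e)) < size (edges G)"
    using assms by (simp_all add: size_Diff1_less)
  have "{# f \<in># edges G. f \<inter> e = {} #} = {# f \<in># edges G - {#e#}. f \<inter> e = {} #}"
    using edge_nonempty[OF assms] by (simp add: filter_diff_mset)
  also have "size \<dots> \<le> size (edges G - {#e#})"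
    by (rule size_filter_mset_lesseq)
  also have "\<dots> < size (edges G)"
    using assms by (simp add: size_Diff1_less)
  finally show "size (edges (extract_edge G e)) < size (edges G)"
    by simp
qed

section \<open>The elimination recurrence\<close>

text \<open>Deletion, contraction and extraction lead from any graph to edgeless ones, so prescribing the
  values on these determines a solution. In this form the condition makes sense for arbitrary ring elements \<open>a\<close>, \<open>b\<close>, \<open>c\<close> and is preserved by
  homomorphisms.\<close>

definition elimination :: "'a \<Rightarrow> 'a \<Rightarrow> 'a \<Rightarrow> ('v multigraph \<Rightarrow> 'a::comm_ring_1) \<Rightarrow> bool" where
  "elimination a b c F \<longleftrightarrow>
     (\<forall>G e. e \<in># edges G \<longrightarrow>
        F G = F (delete_edge G e) + b * F (contract_edge G e) + c * F (extract_edge G e)) \<and>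
     (\<forall>G. edges G = {#} \<longrightarrow> F G = a ^ card (verts G))"

lemma elimination_step:
  "elimination a b c F \<Longrightarrow> e \<in># edges G \<Longrightarrow>
     F G = F (delete_edge G e) + b * F (contract_edge G e) + c * F (extract_edge G e)"
  by (simp add: elimination_def)

text \<open>The family is indexed because the polynomial must serve all members at once: for coloring sums
  the index is the pair of values of \<open>x\<close> and \<open>y\<close>.\<close>

lemma elimination_polynomial:
  assumes "\<And>i. i \<in> I \<Longrightarrow> elimination (a i) (b i) (c i) (F i)"
  shows "\<exists>p. \<forall>i\<in>I. F i G = subst3 p (a i) (b i) (c i)"
proof (induction "size (edges G)" arbitrary: G rule: less_induct)
  case less
  show ?case
  proof (cases "edges G = {#}")
    case True
    then have "\<forall>i\<in>I. F i G = subst3 (var_x ^ card (verts G)) (a i) (b i) (c i)"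
      using assms by (simp add: elimination_def)
    then show ?thesis by blast
  next
    case False
    then obtain e where e: "e \<in># edges G" by auto
    obtain p q r where
      "\<forall>i\<in>I. F i (delete_edge G e) = subst3 p (a i) (b i) (c i)"
      "\<forall>i\<in>I. F i (contract_edge G e) = subst3 q (a i) (b i) (c i)"
      "\<forall>i\<in>I. F i (extract_edge G e) = subst3 r (a i) (b i) (c i)"
      using less size_edges_eliminate[OF e] by meson
    then have "\<forall>i\<in>I. F i G = subst3 (p + var_y * q + var_z * r) (a i) (b i) (c i)"
      using elimination_step[OF assms e] by simp
    then show ?thesis by blast
  qed
qed

lemma elimination_unique:
  assumes "elimination a b c F" "elimination a b c F'"
  shows "F G = F' G"
proof -
  have "\<exists>p. \<forall>f\<in>{F, F'}. f G = subst3 p a b c"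
    by (rule elimination_polynomial) (use assms in auto)
  then show ?thesis by auto
qed

lemma elimination_hom:
  fixes F :: "'v multigraph \<Rightarrow> 'a::comm_ring_1"
  assumes "elimination a b c F" "unital_hom h"
  shows "elimination (h a) (h b) (h c) (\<lambda>G. h (F G))"
  unfolding elimination_def
proof (intro conjI allI impI)
  fix G :: "'v multigraph" and e assume "e \<in># edges G"
  from elimination_step[OF assms(1) this]
  show "h (F G) = h (F (delete_edge G e)) + h b * h (F (contract_edge G e)) + h c * h (F (extract_edge G e))"
    by (simp only: unital_homD[OF assms(2)])
next
  fix G :: "'v multigraph" assume "edges G = {#}"
  then show "h (F G) = h a ^ card (verts G)"
    using assms(1) by (simp add: elimination_def unital_homD[OF assms(2)])
qed

section \<open>Coloring sums\<close>

abbreviation is_low :: "nat \<Rightarrow> ('v \<Rightarrow> nat) \<Rightarrow> 'v set \<Rightarrow> bool" where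
  "is_low y \<phi> f \<equiv> \<exists>c\<le>y. \<forall>w\<in>f. \<phi> w = c"

abbreviation weight :: "nat \<Rightarrow> 'a::comm_ring_1 \<Rightarrow> 'v set multiset \<Rightarrow> ('v \<Rightarrow> nat) \<Rightarrow> 'a" where
  "weight y z E \<phi> \<equiv> z ^ size {# f \<in># E. is_low y \<phi> f #}"

lemma is_low_cong: "(\<And>w. w \<in> f \<Longrightarrow> \<phi> w = \<psi> w) \<Longrightarrow> is_low y \<phi> f \<longleftrightarrow> is_low y \<psi> f"
  by auto

lemma weight_cong:
  "(\<And>f. f \<in># E \<Longrightarrow> is_low y \<phi> f \<longleftrightarrow> is_low y \<psi> f) \<Longrightarrow> weight y z E \<phi> = weight y z E \<psi>"
  by (simp cong: filter_mset_cong)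

lemma weight_image:
  "weight y z (image_mset ((`) g) E) \<phi> = weight y z E (\<phi> \<circ> g)"
  by (simp add: filter_mset_image_mset o_def)

lemma merge_fixes: "w \<notin> e \<Longrightarrow> merge e w = w"
  by (simp add: merge_def)

text \<open>Composition with the merging map identifies the colorings of the contraction with the colorings
  that are constant on \<open>e\<close>. For a loop this is no restriction, in accordance with contraction being
  deletion then.\<close>

lemma coloring_sum_contract:
  assumes e: "e \<in># edges G"
  shows "coloring_sum (contract_edge G e) x y z =
    (\<Sum>\<phi> \<in> {\<phi> \<in> verts G \<rightarrow>\<^sub>E {1..x}. \<exists>c. \<forall>w\<in>e. \<phi> w = c}. weight y z (edges G - {#e#}) \<phi>)"
proof -
  have eV: "e \<subseteq> verts G" and "e \<noteq> {}" using edge_subset[OF e] edge_nonempty[OF e] by auto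
  then obtain u where ue: "u \<in> e" and merge_e: "\<And>w. w \<in> e \<Longrightarrow> merge e w = u"
    by (metis merge_def some_in_eq)
  have merge_in: "merge e w \<in> verts G" if "w \<in> verts G" for w
    using that ue eV merge_e merge_fixes by (metis subsetD)
  have idem: "merge e (merge e w) = merge e w" for w
    using ue merge_e merge_fixes by metis
  show ?thesis
    unfolding coloring_sum_def graph_simps weight_image
  proof (rule sum.reindex_bij_witness[where
        i = "\<lambda>\<phi>. restrict \<phi> (merge e ` verts G)" and j = "\<lambda>\<psi>. restrict (\<psi> \<circ> merge e) (verts G)"])
    fix \<psi> assume psi: "\<psi> \<in> merge e ` verts G \<rightarrow>\<^sub>E {1..x}"
    show "restrict (restrict (\<psi> \<circ> merge e) (verts G)) (merge e ` verts G) = \<psi>"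
      using psi merge_in idem by (auto simp: fun_eq_iff restrict_def PiE_def extensional_def)
    show "restrict (\<psi> \<circ> merge e) (verts G) \<in> {\<phi> \<in> verts G \<rightarrow>\<^sub>E {1..x}. \<exists>c. \<forall>w\<in>e. \<phi> w = c}"
      using psi merge_e eV by (auto simp: PiE_iff subset_iff)
    show "weight y z (edges G - {#e#}) (restrict (\<psi> \<circ> merge e) (verts G))
        = weight y z (edges G - {#e#}) (\<psi> \<circ> merge e)"
      by (intro weight_cong is_low_cong) (auto dest!: in_diffD edge_subset)
  next
    fix \<phi> assume "\<phi> \<in> {\<phi> \<in> verts G \<rightarrow>\<^sub>E {1..x}. \<exists>c. \<forall>w\<in>e. \<phi> w = c}"
    then have phi: "\<phi> \<in> verts G \<rightarrow>\<^sub>E {1..x}" and const: "\<And>w. w \<in> e \<Longrightarrow> \<phi> w = \<phi> u"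
      using ue by auto
    have "\<phi> (merge e w) = \<phi> w" for w
      using const merge_e merge_fixes by metis
    then show "restrict (restrict \<phi> (merge e ` verts G) \<circ> merge e) (verts G) = \<phi>"
      using phi by (auto simp: fun_eq_iff restrict_def PiE_def extensional_def)
    show "restrict \<phi> (merge e ` verts G) \<in> merge e ` verts G \<rightarrow>\<^sub>E {1..x}"
      using phi merge_in by (auto simp: PiE_iff)
  qed
qed

text \<open>Extending a coloring of the extraction by a single color above \<open>y\<close> on \<open>e\<close> can be done in
  \<open>x - y\<close> ways. It leaves the weight unchanged, because an edge that touches \<open>e\<close> has an endpoint
  with a high color and so is not counted.\<close>

lemma coloring_sum_extract:
  assumes e: "e \<in># edges G" and yx: "y \<le> x"
  shows "(of_nat x - of_nat y) * coloring_sum (extract_edge G e) x y z =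
    (\<Sum>\<phi> \<in> {\<phi> \<in> verts G \<rightarrow>\<^sub>E {1..x}. \<exists>c>y. \<forall>w\<in>e. \<phi> w = c}. weight y z (edges G - {#e#}) \<phi>)"
proof -
  have eV: "e \<subseteq> verts G" and "e \<noteq> {}" using edge_subset[OF e] edge_nonempty[OF e] by auto
  then obtain u where ue: "u \<in> e" by auto
  let ?E = "{# f \<in># edges G. f \<inter> e = {} #}"
  let ?ext = "\<lambda>(c, \<psi>) w. if w \<in> e then c else \<psi> w"
  have "(of_nat x - of_nat y) * coloring_sum (extract_edge G e) x y z
      = (\<Sum>c\<in>{y<..x}. \<Sum>\<psi> \<in> verts G - e \<rightarrow>\<^sub>E {1..x}. weight y z ?E \<psi>)"
    using yx by (simp add: coloring_sum_def of_nat_diff)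
  also have "\<dots> = (\<Sum>(c, \<psi>) \<in> {y<..x} \<times> (verts G - e \<rightarrow>\<^sub>E {1..x}). weight y z ?E \<psi>)"
    by (rule sum.cartesian_product)
  also have "\<dots> = (\<Sum>\<phi> \<in> {\<phi> \<in> verts G \<rightarrow>\<^sub>E {1..x}. \<exists>c>y. \<forall>w\<in>e. \<phi> w = c}.
      weight y z (edges G - {#e#}) \<phi>)"
  proof (rule sum.reindex_bij_witness[where i = "\<lambda>\<phi>. (\<phi> u, restrict \<phi> (verts G - e))" and j = ?ext])
    fix p assume p: "p \<in> {y<..x} \<times> (verts G - e \<rightarrow>\<^sub>E {1..x})"
    obtain c \<psi> where p_eq: "p = (c, \<psi>)" by force
    have c: "y < c" "c \<le> x" and psi: "\<psi> \<in> verts G - e \<rightarrow>\<^sub>E {1..x}"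
      using p p_eq by auto
    show "(?ext p u, restrict (?ext p) (verts G - e)) = p"
      using psi ue p_eq by (auto simp: fun_eq_iff restrict_def PiE_def extensional_def)
    show "?ext p \<in> {\<phi> \<in> verts G \<rightarrow>\<^sub>E {1..x}. \<exists>c>y. \<forall>w\<in>e. \<phi> w = c}"
      using psi c p_eq eV by (auto simp: PiE_iff extensional_def)
    have low: "is_low y (?ext p) f \<longleftrightarrow> f \<inter> e = {} \<and> is_low y \<psi> f" for f
    proof (cases "f \<inter> e = {}")
      case True
      then have "is_low y (?ext p) f \<longleftrightarrow> is_low y \<psi> f"
        using p_eq by (intro is_low_cong) auto
      with True show ?thesis by simp
    next
      case False
      then obtain w where "w \<in> f" "w \<in> e" by blast
      then have "\<not> is_low y (?ext p) f" using c p_eq by (auto intro!: bexI[of _ w])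
      with False show ?thesis by simp
    qed
    have "{# f \<in># edges G - {#e#}. is_low y (?ext p) f #} = {# f \<in># edges G. is_low y (?ext p) f #}"
      using low[of e] ue by (auto simp: filter_diff_mset)
    also have "\<dots> = {# f \<in># ?E. is_low y \<psi> f #}"
      by (simp add: low filter_filter_mset conj_commute)
    finally show "weight y z (edges G - {#e#}) (?ext p) = (case p of (c, \<psi>) \<Rightarrow> weight y z ?E \<psi>)"
      by (simp add: p_eq)
  next
    fix \<phi> assume "\<phi> \<in> {\<phi> \<in> verts G \<rightarrow>\<^sub>E {1..x}. \<exists>c>y. \<forall>w\<in>e. \<phi> w = c}"
    then have phi: "\<phi> \<in> verts G \<rightarrow>\<^sub>E {1..x}" and const: "\<And>w. w \<in> e \<Longrightarrow> \<phi> w = \<phi> u"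
      and yu: "y < \<phi> u" using ue by auto
    show "(\<phi> u, restrict \<phi> (verts G - e)) \<in> {y<..x} \<times> (verts G - e \<rightarrow>\<^sub>E {1..x})"
      using phi yu ue eV by (auto simp: PiE_iff)
    show "?ext (\<phi> u, restrict \<phi> (verts G - e)) = \<phi>"
      using phi eV by (auto simp: fun_eq_iff restrict_def PiE_def extensional_def const[symmetric])
  qed
  finally show ?thesis .
qed

text \<open>With \<open>L\<close>, \<open>U\<close> and \<open>C\<close> the colorings that give \<open>e\<close> a single low, a single high and
  any single color, the edge \<open>e\<close> contributes \<open>z - 1\<close> times the sum over \<open>L\<close>. The sum over
  \<open>C\<close> is the contraction and the one over \<open>U\<close> is \<open>x - y\<close> times the extraction.\<close>

lemma elimination_coloring_sum:
  assumes yx: "y \<le> x"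
  shows "elimination (of_nat x) (z - 1) ((1 - z) * (of_nat x - of_nat y))
           (\<lambda>G. coloring_sum G x y (z :: 'a::comm_ring_1))"
  unfolding elimination_def
proof (intro conjI allI impI)
  fix G :: "'v multigraph" and e
  assume e: "e \<in># edges G"
  define A where "A = verts G \<rightarrow>\<^sub>E {1..x}"
  define L where "L = {\<phi> \<in> A. is_low y \<phi> e}"
  define C where "C = {\<phi> \<in> A. \<exists>c. \<forall>w\<in>e. \<phi> w = c}"
  define U where "U = {\<phi> \<in> A. \<exists>c>y. \<forall>w\<in>e. \<phi> w = c}"
  define W where "W = weight y z (edges G - {#e#})"
  have finA: "finite A" by (simp add: A_def finite_PiE)
  have C: "C = L \<union> U" unfolding C_def L_def U_def by (auto; metis not_le)
  have disj: "L \<inter> U = {}" using edge_nonempty[OF e] unfolding L_def U_def by fastforce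
  have fin: "finite L" "finite U" using finA by (auto simp: L_def U_def)
  have weight: "weight y z (edges G) \<phi> = W \<phi> + (if is_low y \<phi> e then (z - 1) * W \<phi> else 0)" for \<phi>
  proof -
    have "edges G = add_mset e (edges G - {#e#})" using e by simp
    then have "weight y z (edges G) \<phi> = weight y z (add_mset e (edges G - {#e#})) \<phi>" by simp
    then show ?thesis by (auto simp: W_def algebra_simps)
  qed
  have "coloring_sum G x y z
      = (\<Sum>\<phi>\<in>A. W \<phi>) + (\<Sum>\<phi>\<in>A. if is_low y \<phi> e then (z - 1) * W \<phi> else 0)"
    by (simp only: coloring_sum_def weight A_def sum.distrib)
  also have "(\<Sum>\<phi>\<in>A. if is_low y \<phi> e then (z - 1) * W \<phi> else 0) = (z - 1) * (\<Sum>\<phi>\<in>L. W \<phi>)"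
    unfolding L_def sum.inter_filter[OF finA] sum_distrib_left by (rule sum.cong) auto
  also have "(\<Sum>\<phi>\<in>A. W \<phi>) = coloring_sum (delete_edge G e) x y z"
    by (simp add: coloring_sum_def A_def W_def)
  also have "(\<Sum>\<phi>\<in>L. W \<phi>) = (\<Sum>\<phi>\<in>C. W \<phi>) - (\<Sum>\<phi>\<in>U. W \<phi>)"
    using fin disj by (simp add: C sum.union_disjoint)
  also have "(\<Sum>\<phi>\<in>C. W \<phi>) = coloring_sum (contract_edge G e) x y z"
    by (simp only: coloring_sum_contract[OF e] C_def A_def W_def)
  also have "(\<Sum>\<phi>\<in>U. W \<phi>) = (of_nat x - of_nat y) * coloring_sum (extract_edge G e) x y z"
    by (simp only: coloring_sum_extract[OF e yx] U_def A_def W_def)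
  finally show "coloring_sum G x y z = coloring_sum (delete_edge G e) x y z
      + (z - 1) * coloring_sum (contract_edge G e) x y z
      + (1 - z) * (of_nat x - of_nat y) * coloring_sum (extract_edge G e) x y z"
    by (simp add: algebra_simps)
next
  fix G :: "'v multigraph"
  assume "edges G = {#}"
  then show "coloring_sum G x y z = of_nat x ^ card (verts G)"
    by (simp add: coloring_sum_def card_PiE)
qed

lemma coloring_sum_union:
  assumes disj: "verts G \<inter> verts H = {}"
  shows "coloring_sum (union_graph G H) x y z = coloring_sum G x y z * coloring_sum H x y z"
proof -
  let ?V = "verts G" and ?W = "verts H"
  let ?glue = "\<lambda>(\<phi>, \<psi>) w. if w \<in> ?V then \<phi> w else \<psi> w"
  have "coloring_sum G x y z * coloring_sum H x y z
      = (\<Sum>(\<phi>, \<psi>) \<in> (?V \<rightarrow>\<^sub>E {1..x}) \<times> (?W \<rightarrow>\<^sub>E {1..x}). weight y z (edges G) \<phi> * weight y z (edges H) \<psi>)"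
    by (simp add: coloring_sum_def sum_product sum.cartesian_product)
  also have "\<dots> = (\<Sum>\<phi> \<in> ?V \<union> ?W \<rightarrow>\<^sub>E {1..x}. weight y z (edges G + edges H) \<phi>)"
  proof (rule sum.reindex_bij_witness[where
        i = "\<lambda>\<phi>. (restrict \<phi> ?V, restrict \<phi> ?W)" and j = ?glue])
    fix p assume p: "p \<in> (?V \<rightarrow>\<^sub>E {1..x}) \<times> (?W \<rightarrow>\<^sub>E {1..x})"
    obtain \<phi> \<psi> where p_eq: "p = (\<phi>, \<psi>)" by force
    have phi: "\<phi> \<in> ?V \<rightarrow>\<^sub>E {1..x}" and psi: "\<psi> \<in> ?W \<rightarrow>\<^sub>E {1..x}"
      using p p_eq by auto
    show "(restrict (?glue p) ?V, restrict (?glue p) ?W) = p"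
      using phi psi p_eq disj by (auto simp: fun_eq_iff restrict_def PiE_def extensional_def)
    show "?glue p \<in> ?V \<union> ?W \<rightarrow>\<^sub>E {1..x}"
      using phi psi p_eq by (auto simp: PiE_iff extensional_def)
    have "weight y z (edges G) (?glue p) = weight y z (edges G) \<phi>"
      by (intro weight_cong is_low_cong) (use p_eq in \<open>auto dest!: edge_subset\<close>)
    moreover have "weight y z (edges H) (?glue p) = weight y z (edges H) \<psi>"
      by (intro weight_cong is_low_cong) (use p_eq disj in \<open>auto dest!: edge_subset\<close>)
    ultimately show "weight y z (edges G + edges H) (?glue p)
        = (case p of (\<phi>, \<psi>) \<Rightarrow> weight y z (edges G) \<phi> * weight y z (edges H) \<psi>)"
      by (simp add: p_eq power_add)
  next
    fix \<phi> assume phi: "\<phi> \<in> ?V \<union> ?W \<rightarrow>\<^sub>E {1..x}"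
    then show "?glue (restrict \<phi> ?V, restrict \<phi> ?W) = \<phi>"
      by (auto simp: fun_eq_iff restrict_def PiE_def extensional_def)
    show "(restrict \<phi> ?V, restrict \<phi> ?W) \<in> (?V \<rightarrow>\<^sub>E {1..x}) \<times> (?W \<rightarrow>\<^sub>E {1..x})"
      using phi by (auto simp: PiE_iff)
  qed
  finally show ?thesis by (simp add: coloring_sum_def)
qed

lemma coloring_sum_isomorphic:
  assumes "isomorphic G H"
  shows "coloring_sum G x y z = coloring_sum H x y z"
proof -
  let ?V = "verts G" and ?W = "verts H"
  obtain f where f: "bij_betw f ?V ?W" and E: "edges H = image_mset ((`) f) (edges G)"
    using assms by (auto simp: isomorphic_def)
  let ?g = "inv_into ?V f"
  have fW: "\<And>w. w \<in> ?V \<Longrightarrow> f w \<in> ?W" and gV: "\<And>w. w \<in> ?W \<Longrightarrow> ?g w \<in> ?V"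
    and gf: "\<And>w. w \<in> ?V \<Longrightarrow> ?g (f w) = w" and fg: "\<And>w. w \<in> ?W \<Longrightarrow> f (?g w) = w"
    using f by (auto simp: bij_betw_def inv_into_into f_inv_into_f)
  show ?thesis
    unfolding coloring_sum_def E weight_image
  proof (rule sum.reindex_bij_witness[where
        i = "\<lambda>\<psi>. restrict (\<psi> \<circ> f) ?V" and j = "\<lambda>\<phi>. restrict (\<phi> \<circ> ?g) ?W"])
    fix \<phi> assume phi: "\<phi> \<in> ?V \<rightarrow>\<^sub>E {1..x}"
    show "restrict (restrict (\<phi> \<circ> ?g) ?W \<circ> f) ?V = \<phi>"
      using phi fW gf by (auto simp: fun_eq_iff restrict_def PiE_def extensional_def)
    show "restrict (\<phi> \<circ> ?g) ?W \<in> ?W \<rightarrow>\<^sub>E {1..x}"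
      using phi gV by (auto simp: PiE_iff)
    show "weight y z (edges G) (restrict (\<phi> \<circ> ?g) ?W \<circ> f) = weight y z (edges G) \<phi>"
      by (intro weight_cong is_low_cong) (use fW gf in \<open>auto dest!: edge_subset\<close>)
  next
    fix \<psi> assume psi: "\<psi> \<in> ?W \<rightarrow>\<^sub>E {1..x}"
    show "restrict (restrict (\<psi> \<circ> f) ?V \<circ> ?g) ?W = \<psi>"
      using psi gV fg by (auto simp: fun_eq_iff restrict_def PiE_def extensional_def)
    show "restrict (\<psi> \<circ> f) ?V \<in> ?V \<rightarrow>\<^sub>E {1..x}"
      using psi fW by (auto simp: PiE_iff)
  qed
qed

section \<open>The trivariate chromatic polynomial\<close>

text \<open>This is the existence of the polynomial: the recurrence expresses all coloring sums of \<open>G\<close> by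
  one polynomial in \<open>x\<close>, \<open>z - 1\<close> and \<open>(1 - z)(x - y)\<close>, which is a polynomial in \<open>x\<close>,
  \<open>y\<close> and \<open>z\<close>.\<close>

lemma trivariate_chromatic_eval:
  assumes "y \<le> x"
  shows "subst3 (trivariate_chromatic G) (of_nat x) (of_nat y) [:0, 1:]
    = coloring_sum G x y ([:0, 1:] :: int poly)"
proof -
  let ?ok = "\<lambda>p. \<forall>x y :: nat. y \<le> x \<longrightarrow>
        subst3 p (of_nat x) (of_nat y) [:0, 1:] = coloring_sum G x y ([:0, 1:] :: int poly)"
  let ?z = "[:0, 1:] :: int poly"
  obtain p where p: "\<And>x y. y \<le> x \<Longrightarrow> coloring_sum G x y ?z
      = subst3 p (of_nat x) (?z - 1) ((1 - ?z) * (of_nat x - of_nat y))"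
    using elimination_polynomial[of "{(x, y). y \<le> x}" "\<lambda>(x, y). of_nat x" "\<lambda>_. ?z - 1"
        "\<lambda>(x, y). (1 - ?z) * (of_nat x - of_nat y)" "\<lambda>(x, y) G. coloring_sum G x y ?z" G]
      elimination_coloring_sum[of _ _ ?z]
    by (auto simp: split_beta)
  have "?ok (subst3 p var_x (var_z - 1) ((1 - var_z) * (var_x - var_y)))"
    using p by (simp add: subst3_subst3)
  moreover have "q = q'" if "?ok q" "?ok q'" for q q'
    using that by (intro poly3_eqI) simp
  ultimately have "\<exists>!p. ?ok p" by blast
  from theI'[OF this] show ?thesis
    using assms unfolding trivariate_chromatic_def by blast
qed

lemma elimination_trivariate_chromatic:
  "elimination var_x (var_z - 1) ((1 - var_z) * (var_x - var_y)) trivariate_chromatic"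
  unfolding elimination_def
proof (intro conjI allI impI; rule poly3_eqI)
  fix G :: "'v multigraph" and e and x y :: nat
  assume "e \<in># edges G" "y \<le> x"
  then show "subst3 (trivariate_chromatic G) (of_nat x) (of_nat y) ([:0, 1:] :: int poly)
    = subst3 (trivariate_chromatic (delete_edge G e) + (var_z - 1) * trivariate_chromatic (contract_edge G e)
        + (1 - var_z) * (var_x - var_y) * trivariate_chromatic (extract_edge G e))
        (of_nat x) (of_nat y) [:0, 1:]"
    using elimination_step[OF elimination_coloring_sum[of y x "[:0, 1:] :: int poly"], of e G]
    by (simp add: trivariate_chromatic_eval)
next
  fix G :: "'v multigraph" and x y :: nat
  assume "edges G = {#}" "y \<le> x"
  then show "subst3 (trivariate_chromatic G) (of_nat x) (of_nat y) ([:0, 1:] :: int poly)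
    = subst3 (var_x ^ card (verts G)) (of_nat x) (of_nat y) [:0, 1:]"
    using elimination_coloring_sum[of y x "[:0, 1:] :: int poly", where ?'b = 'v]
    by (simp add: trivariate_chromatic_eval elimination_def)
qed

lemma trivariate_chromatic_union:
  "verts G \<inter> verts H = {} \<Longrightarrow>
    trivariate_chromatic (union_graph G H) = trivariate_chromatic G * trivariate_chromatic H"
  by (rule poly3_eqI) (simp add: trivariate_chromatic_eval coloring_sum_union)

lemma trivariate_chromatic_isomorphic:
  "isomorphic G H \<Longrightarrow> trivariate_chromatic G = trivariate_chromatic H"
  by (rule poly3_eqI) (simp add: trivariate_chromatic_eval coloring_sum_isomorphic)

section \<open>The edge elimination polynomial\<close>

lemma is_edge_elimination_edgeless:
  assumes F: "is_edge_elimination F" and "edges G = {#}"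
  shows "F G = var_x ^ card (verts G)"
  using assms(2)
proof (induction "card (verts G)" arbitrary: G)
  case 0
  then have "G = empty_graph" by (intro multigraph_eqI) simp_all
  then show ?case using F by (simp add: is_edge_elimination_def)
next
  case (Suc n)
  then obtain v where v: "v \<in> verts G" by fastforce
  \<comment> \<open>Extracting the singleton of \<open>v\<close>, which need not be an edge, removes the vertex \<open>v\<close>.\<close>
  let ?G' = "extract_edge G {v}"
  have "G = union_graph (K1 v) ?G'"
    using v Suc.prems by (intro multigraph_eqI) auto
  moreover have "F (union_graph (K1 v) ?G') = F (K1 v) * F ?G'"
    using F unfolding is_edge_elimination_def by simp
  moreover have "F (K1 v) = var_x"
    using F by (simp add: is_edge_elimination_def)
  moreover have "F ?G' = var_x ^ n"
    using Suc.hyps(1)[of ?G'] Suc.hyps(2)[symmetric] Suc.prems v by simp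
  ultimately show ?case using Suc.hyps(2)[symmetric] by simp
qed

lemma is_edge_elimination_elimination:
  assumes "is_edge_elimination F"
  shows "elimination var_x var_y var_z F"
  unfolding elimination_def
  using assms is_edge_elimination_edgeless[OF assms] by (auto simp: is_edge_elimination_def)

text \<open>Existence of \<open>\<xi>\<close> and its formula are proved together: the substituted trivariate chromatic
  polynomial solves the recurrence of \<open>\<xi>\<close>, hence consists of polynomials in spite of the
  denominator \<open>y\<close>, and inherits invariance and multiplicativity.\<close>

lemma edge_elimination_eq_trivariate_chromatic:
  fixes G :: "'v multigraph"
  defines "X \<equiv> to_fract var_x :: ratfun3" and "Y \<equiv> to_fract var_y" and "Z \<equiv> to_fract var_z"
  shows "is_edge_elimination (edge_elimination :: 'v multigraph \<Rightarrow> poly3)"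
    and "to_fract (edge_elimination G) = subst3 (trivariate_chromatic G) X (X + Z / Y) (Y + 1)"
proof -
  define F :: "'v multigraph \<Rightarrow> ratfun3"
    where "F = (\<lambda>G. subst3 (trivariate_chromatic G) X (X + Z / Y) (Y + 1))"
  have "Y \<noteq> 0" by (simp add: Y_def var_y_def)
  then have "(1 - (Y + 1)) * (X - (X + Z / Y)) = Z" by simp
  then have F: "elimination X Y Z F"
    using elimination_hom[OF elimination_trivariate_chromatic unital_hom_subst3[of X "X + Z / Y" "Y + 1"]]
    unfolding F_def by simp
  \<comment> \<open>The denominators cancel, since the recurrence of \<open>F\<close> involves only \<open>X\<close>, \<open>Y\<close> and \<open>Z\<close>.\<close>
  have "\<exists>p. F G = to_fract p" for G
  proof -
    have "\<exists>p. \<forall>F'\<in>{F}. F' G = subst3 p X Y Z"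
      by (rule elimination_polynomial) (use F in simp)
    then obtain p where "F G = subst3 p X Y Z" by blast
    also have "\<dots> = to_fract p" unfolding X_def Y_def Z_def by (rule to_fract_eq_subst3[symmetric])
    finally show ?thesis ..
  qed
  then obtain f where f: "\<And>G. F G = to_fract (f G)" by metis
  have "is_edge_elimination f"
    unfolding is_edge_elimination_def
  proof (intro conjI allI impI)
    fix G H :: "'v multigraph" assume "isomorphic G H"
    then have "F G = F H" unfolding F_def using trivariate_chromatic_isomorphic by metis
    then show "f G = f H" by (simp add: f)
  next
    fix G :: "'v multigraph" and e assume "e \<in># edges G"
    from elimination_step[OF F this]
    have "to_fract (f G)
        = to_fract (f (delete_edge G e) + var_y * f (contract_edge G e) + var_z * f (extract_edge G e))"
      by (simp add: f Y_def Z_def)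
    then show "f G = f (delete_edge G e) + var_y * f (contract_edge G e) + var_z * f (extract_edge G e)"
      by (simp only: to_fract_eq_iff)
  next
    fix G H :: "'v multigraph" assume "verts G \<inter> verts H = {}"
    then have "F (union_graph G H) = F G * F H"
      unfolding F_def using trivariate_chromatic_union by (metis subst3_hom(3))
    then have "to_fract (f (union_graph G H)) = to_fract (f G * f H)"
      by (simp add: f)
    then show "f (union_graph G H) = f G * f H" by (simp only: to_fract_eq_iff)
  next
    fix v :: 'v
    have "F (K1 v) = X" using F by (simp add: elimination_def)
    then show "f (K1 v) = var_x" by (simp add: f X_def)
  next
    have "F empty_graph = 1" using F by (simp add: elimination_def)
    then have "to_fract (f empty_graph) = to_fract 1" by (simp add: f)
    then show "f empty_graph = 1" by (simp only: to_fract_eq_iff)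
  qed
  moreover have "f' = f" if "is_edge_elimination f'" for f'
    using elimination_unique[OF is_edge_elimination_elimination[OF that]
        is_edge_elimination_elimination[OF \<open>is_edge_elimination f\<close>]] by blast
  ultimately have eq: "edge_elimination = f"
    unfolding edge_elimination_def by (rule the_equality)
  then show "is_edge_elimination (edge_elimination :: 'v multigraph \<Rightarrow> poly3)"
    using \<open>is_edge_elimination f\<close> by simp
  show "to_fract (edge_elimination G) = subst3 (trivariate_chromatic G) X (X + Z / Y) (Y + 1)"
    using f[of G] by (simp add: eq F_def)
qed

text \<open>Undoing the substitution of the preceding lemma would mean substituting into rational
  functions. Comparing two solutions of the same recurrence avoids this.\<close>

lemma trivariate_chromatic_eq_edge_elimination:
  fixes G :: "'v multigraph"
  defines "X \<equiv> to_fract var_x :: ratfun3" and "Y \<equiv> to_fract var_y" and "Z \<equiv> to_fract var_z"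
  shows "to_fract (trivariate_chromatic G) = subst3 (edge_elimination G) X (Z - 1) ((1 - Z) * (X - Y))"
proof (rule elimination_unique)
  show "elimination X (Z - 1) ((1 - Z) * (X - Y))
      (\<lambda>G :: 'v multigraph. to_fract (trivariate_chromatic G))"
    using elimination_hom[OF elimination_trivariate_chromatic unital_hom_to_fract]
    by (simp add: X_def Y_def Z_def)
  show "elimination X (Z - 1) ((1 - Z) * (X - Y))
      (\<lambda>G :: 'v multigraph. subst3 (edge_elimination G) X (Z - 1) ((1 - Z) * (X - Y)))"
    using elimination_hom[OF is_edge_elimination_elimination[OF edge_elimination_eq_trivariate_chromatic(1)]
        unital_hom_subst3[of X "Z - 1" "(1 - Z) * (X - Y)"]] by simp
qed

theorem corollary7:
  fixes G :: "'v multigraph" and X Y Z :: ratfun3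
  defines "X \<equiv> to_fract var_x" and "Y \<equiv> to_fract var_y" and "Z \<equiv> to_fract var_z"
  shows "equivalent_graph_polynomials
           (trivariate_chromatic :: 'v multigraph \<Rightarrow> poly3) edge_elimination \<and>
         to_fract (trivariate_chromatic G) = subst3 (edge_elimination G) X (Z - 1) ((1 - Z) * (X - Y)) \<and>
         to_fract (edge_elimination G) = subst3 (trivariate_chromatic G) X (X + Z / Y) (Y + 1)"
proof -
  note P = trivariate_chromatic_eq_edge_elimination[where ?'v = 'v, folded X_def Y_def Z_def]
  note xi = edge_elimination_eq_trivariate_chromatic(2)[where ?'v = 'v, folded X_def Y_def Z_def]
  have inv: "inv to_fract (to_fract p) = p" for p :: poly3
    by (rule inv_f_f) (simp add: inj_def)
  have "\<forall>G :: 'v multigraph. trivariate_chromatic G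
      = inv to_fract (subst3 (edge_elimination G) X (Z - 1) ((1 - Z) * (X - Y)))"
    by (simp add: inv flip: P)
  moreover have "\<forall>G :: 'v multigraph. edge_elimination G
      = inv to_fract (subst3 (trivariate_chromatic G) X (X + Z / Y) (Y + 1))"
    by (simp add: inv flip: xi)
  ultimately have "equivalent_graph_polynomials
      (trivariate_chromatic :: 'v multigraph \<Rightarrow> poly3) edge_elimination"
    unfolding equivalent_graph_polynomials_def
    by (intro conjI
        exI[of _ "\<lambda>p. inv to_fract (subst3 p X (Z - 1) ((1 - Z) * (X - Y)))"]
        exI[of _ "\<lambda>p. inv to_fract (subst3 p X (X + Z / Y) (Y + 1))"])
  then show ?thesis using P xi by blast
qed

end
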